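(* Let $A_1,A_2,A_3\in M_2(\mathbb{C})$ be self-adjoint, written as $A_j=\sum_{k=0}^3 a_{jk}\sigma_k$ with $a_{jk}\in\mathbb{R}$, and suppose $A_1$ is diagonal, i.e. $a_{11}=a_{12}=0$. Put $\alpha_2=a_{22}+i\,a_{21}$ and $\alpha_3=a_{31}+i\,a_{32}$. For $x=(x_1,x_2,x_3)\in\mathbb{R}^3$ let $D(x)=\det L_x(A_1,A_2,A_3)$ be the determinant of the localizer. Then for every $x\in\mathbb{R}^3$, $$\begin{aligned} D(x)={}&\Big(\sum_{j=1}^3 \big((a_{j0}-x_j)-a_{j3}\big)^2\Big)\Big(\sum_{j=1}^3 \big((a_{j0}-x_j)+a_{j3}\big)^2\Big)\\ &+2|\alpha_2|^2\Big[\big((a_{10}-x_1)^2-a_{13}^2\big)-\big((a_{20}-x_2)^2-a_{23}^2\big)+\big((a_{30}-x_3)^2-a_{33}^2\big)\Big]\\ &+2|\alpha_3|^2\Big[\big((a_{10}-x_1)^2-a_{13}^2\big)+\big((a_{20}-x_2)^2-a_{23}^2\big)-\big((a_{30}-x_3)^2-a_{33}^2\big)\Big]\\ &-4\,\operatorname{Im}(\alpha_2\alpha_3)\Big[\big((a_{20}-x_2)+a_{23}\big)\big((a_{30}-x_3)-a_{33}\big)+\big((a_{20}-x_2)-a_{23}\big)\big((a_{30}-x_3)+a_{33}\big)\Big]\\ &+\big|\alpha_2^2-\overline{\alpha_3}^{\,2}\big|^2 . \end{aligned}$$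
   Context: Let $\sigma_0=\begin{bmatrix}1&0\\0&1\end{bmatrix}$, $\sigma_1=\begin{bmatrix}0&1\\1&0\end{bmatrix}$, $\sigma_2=\begin{bmatrix}0&-i\\i&0\end{bmatrix}$, $\sigma_3=\begin{bmatrix}1&0\\0&-1\end{bmatrix}$. Every self-adjoint matrix in $M_2(\mathbb{C})$ is uniquely a real linear combination of $\sigma_0,\dots,\sigma_3$. The localizer of self-adjoint matrices $A_1,A_2,A_3\in M_2(\mathbb{C})$ at $x=(x_1,x_2,x_3)\in\mathbb{R}^3$ is the $4\times4$ matrix $L_x(A_1,A_2,A_3)=\sum_{j=1}^3 (A_j-x_j\sigma_0)\otimes\sigma_j$, where $\otimes$ is the Kronecker product. *)

theory Defs
  imports "HOL-Analysis.Analysis"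
begin

definition self_adjoint :: "complex^'n^'n \<Rightarrow> bool" where
  "self_adjoint A \<longleftrightarrow> (\<chi> i j. cnj (A $ j $ i)) = A"

(* The values at indices above 3 are junk and never used. *)
definition pauli :: "nat \<Rightarrow> complex^2^2" where
  "pauli k =
    (if k = 0 then vector [vector [1, 0], vector [0, 1]]
     else if k = 1 then vector [vector [0, 1], vector [1, 0]]
     else if k = 2 then vector [vector [0, - \<i>], vector [\<i>, 0]]
     else vector [vector [1, 0], vector [0, -1]])"

(* Rows and columns are indexed by pairs (outer block index, index within the block);
   in lexicographic order this is the usual block matrix with blocks A_ij B. *)
definition kronecker ::
  "'a::times^'n^'m \<Rightarrow> 'a^'q^'p \<Rightarrow> 'a^('n \<times> 'q)^('m \<times> 'p)" (infixl "\<otimes>\<^sub>K" 70) where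
  "A \<otimes>\<^sub>K B = (\<chi> r c. A $ fst r $ fst c * B $ snd r $ snd c)"

definition localizer ::
  "complex^2^2 \<Rightarrow> complex^2^2 \<Rightarrow> complex^2^2 \<Rightarrow> real^3 \<Rightarrow> complex^(2 \<times> 2)^(2 \<times> 2)" where
  "localizer A1 A2 A3 x =
     (A1 - (x $ 1) *\<^sub>R pauli 0) \<otimes>\<^sub>K pauli 1
   + (A2 - (x $ 2) *\<^sub>R pauli 0) \<otimes>\<^sub>K pauli 2
   + (A3 - (x $ 3) *\<^sub>R pauli 0) \<otimes>\<^sub>K pauli 3"

end

theory Submission
  imports Defs
begin

text \<open>
  Read along its first tensor factor, the localizer is a two-by-two block matrix
  whose blocks are combinations \<open>u \<cdot> \<sigma> = u\<^sub>1 \<sigma>\<^sub>1 + u\<^sub>2 \<sigma>\<^sub>2 + u\<^sub>3 \<sigma>\<^sub>3\<close>: the block at position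
  \<open>(p, q)\<close> collects the \<open>(p, q)\<close> entries of the three matrices \<open>A\<^sub>j - x\<^sub>j\<close>. Call the four
  coefficient vectors \<open>u, w\<close> (top) and \<open>z, v\<close> (bottom).

  For two-by-two blocks,
  \<open>det [P, Q; R, S] = det P det S + det Q det R - tr (adj P Q adj S R)\<close>.
  The algebra of the Pauli matrices gives \<open>det (u \<cdot> \<sigma>) = - u \<cdot> u\<close> and
  \<open>adj (u \<cdot> \<sigma>) = - u \<cdot> \<sigma>\<close>, and the trace of a product of four of them is
  \<open>tr ((u \<cdot> \<sigma>) (w \<cdot> \<sigma>) (v \<cdot> \<sigma>) (z \<cdot> \<sigma>)) = 2 ((u \<cdot> w) (v \<cdot> z) - (u \<cdot> v) (w \<cdot> z) + (u \<cdot> z) (w \<cdot> v))\<close>.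
  So the determinant depends only on the bilinear products of the four vectors
  (\<open>det_pauli_blocks\<close>).

  In the case at hand \<open>u\<close> and \<open>v\<close> are the real vectors with entries
  \<open>(a\<^sub>j\<^sub>0 - x\<^sub>j) + a\<^sub>j\<^sub>3\<close> and \<open>(a\<^sub>j\<^sub>0 - x\<^sub>j) - a\<^sub>j\<^sub>3\<close>, the vector \<open>z\<close> is the conjugate of \<open>w\<close>
  because the \<open>A\<^sub>j\<close> are self-adjoint, and
  \<open>w = (0, - \<i> \<alpha>\<^sub>2, cnj \<alpha>\<^sub>3)\<close>, where the zero says that \<open>A\<^sub>1\<close> is diagonal. The term \<open>(u \<cdot> u) (v \<cdot> v)\<close> is
  the product of the two sums of squares, \<open>(w \<cdot> w) (z \<cdot> z)\<close> is the squared modulus of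
  \<open>\<alpha>\<^sub>2\<^sup>2 - (cnj \<alpha>\<^sub>3)\<^sup>2\<close>, and the rest is \<open>2 (u \<cdot> v) (w \<cdot> z) - 4 Re ((u \<cdot> w) (v \<cdot> z))\<close>. Its terms
  with \<open>w\<^sub>j z\<^sub>j\<close> are those with \<open>|\<alpha>\<^sub>2|\<^sup>2\<close> and \<open>|\<alpha>\<^sub>3|\<^sup>2\<close>; the mixed ones carry the factor
  \<open>Re (w\<^sub>2 z\<^sub>3) = Im (\<alpha>\<^sub>2 \<alpha>\<^sub>3)\<close>.
\<close>

text \<open>
  Laplace expansion along the two upper rows: each product pairs a minor of these
  rows with the complementary minor of the lower ones.
\<close>
lemma det_2_times_2:
  fixes M :: "'a::comm_ring_1^(2 \<times> 2)^(2 \<times> 2)"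
  defines "minor \<equiv> \<lambda>i c d. M $ (i, 1) $ c * M $ (i, 2) $ d - M $ (i, 1) $ d * M $ (i, 2) $ c"
  shows "det M =
      minor 1 (1, 1) (1, 2) * minor 2 (2, 1) (2, 2)
    - minor 1 (1, 1) (2, 1) * minor 2 (1, 2) (2, 2)
    + minor 1 (1, 1) (2, 2) * minor 2 (1, 2) (2, 1)
    + minor 1 (1, 2) (2, 1) * minor 2 (1, 1) (2, 2)
    - minor 1 (1, 2) (2, 2) * minor 2 (1, 1) (2, 1)
    + minor 1 (2, 1) (2, 2) * minor 2 (1, 1) (1, 2)"
proof -
  have U: "(UNIV :: (2 \<times> 2) set) = {(1, 1), (1, 2), (2, 1), (2, 2)}"
    by (auto simp: UNIV_2 simp flip: UNIV_Times_UNIV)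
  show ?thesis
    unfolding det_def U minor_def
    by (simp add: sum_over_permutations_insert sign_compose permutation_compose
        permutation_swap_id sign_swap_id sign_id permutes_sing transpose_def algebra_simps)
qed

text \<open>
  The scalar product is bilinear, also for complex vectors: it comes from
  \<open>(u \<cdot> \<sigma>)\<^sup>2 = (u \<cdot> u) 1\<close>, which involves no conjugation.
\<close>
definition bdot :: "complex^3 \<Rightarrow> complex^3 \<Rightarrow> complex" where
  "bdot u v = (\<Sum>j\<in>UNIV. u $ j * v $ j)"

text \<open>
  This is the block determinant formula combined with the trace of a product of four Pauli
  combinations. Here the Pauli matrices are the second tensor factor, so that
  \<open>u, w, z, v\<close> are the coefficient vectors of the four blocks.
\<close>
lemma det_pauli_blocks:
  fixes u w z v :: "complex^3"
  defines "B \<equiv> \<lambda>j. vector [vector [u $ j, w $ j], vector [z $ j, v $ j]] :: complex^2^2"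
  shows "det (B 1 \<otimes>\<^sub>K pauli 1 + B 2 \<otimes>\<^sub>K pauli 2 + B 3 \<otimes>\<^sub>K pauli 3) =
      bdot u u * bdot v v + bdot w w * bdot z z
    + 2 * (bdot u v * bdot w z - bdot u w * bdot v z - bdot u z * bdot v w)"
proof -
  have i: "\<i> * (\<i> * c) = - c" for c :: complex
    by (simp flip: mult.assoc)
  show ?thesis
    unfolding det_2_times_2 B_def bdot_def sum_3
    by (simp add: kronecker_def pauli_def algebra_simps i)
qed

lemma sum_pauli:
  "(\<Sum>k=0..3. c k *\<^sub>R pauli k) =
    vector [vector [of_real (c 0 + c 3), Complex (c 1) (- c 2)],
            vector [Complex (c 1) (c 2), of_real (c 0 - c 3)]]"
  by (simp add: vec_eq_iff forall_2 pauli_def numeral_eq_Suc complex_eq_iff)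

theorem proposition2p1:
  fixes A1 A2 A3 :: "complex^2^2"
    and a :: "nat \<Rightarrow> nat \<Rightarrow> real"
    and \<alpha>2 \<alpha>3 :: complex
    and x :: "real^3"
  assumes "self_adjoint A1" and "self_adjoint A2" and "self_adjoint A3"
    and "A1 = (\<Sum>k=0..3. a 1 k *\<^sub>R pauli k)"
    and "A2 = (\<Sum>k=0..3. a 2 k *\<^sub>R pauli k)"
    and "A3 = (\<Sum>k=0..3. a 3 k *\<^sub>R pauli k)"
    and "a 1 1 = 0" and "a 1 2 = 0"
    and "\<alpha>2 = of_real (a 2 2) + \<i> * of_real (a 2 1)"
    and "\<alpha>3 = of_real (a 3 1) + \<i> * of_real (a 3 2)"
  shows "det (localizer A1 A2 A3 x) = complex_of_real (
      (((a 1 0 - x $ 1) - a 1 3)\<^sup>2 + ((a 2 0 - x $ 2) - a 2 3)\<^sup>2 + ((a 3 0 - x $ 3) - a 3 3)\<^sup>2)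
      * (((a 1 0 - x $ 1) + a 1 3)\<^sup>2 + ((a 2 0 - x $ 2) + a 2 3)\<^sup>2 + ((a 3 0 - x $ 3) + a 3 3)\<^sup>2)
    + 2 * (cmod \<alpha>2)\<^sup>2 *
        (((a 1 0 - x $ 1)\<^sup>2 - (a 1 3)\<^sup>2) - ((a 2 0 - x $ 2)\<^sup>2 - (a 2 3)\<^sup>2)
          + ((a 3 0 - x $ 3)\<^sup>2 - (a 3 3)\<^sup>2))
    + 2 * (cmod \<alpha>3)\<^sup>2 *
        (((a 1 0 - x $ 1)\<^sup>2 - (a 1 3)\<^sup>2) + ((a 2 0 - x $ 2)\<^sup>2 - (a 2 3)\<^sup>2)
          - ((a 3 0 - x $ 3)\<^sup>2 - (a 3 3)\<^sup>2))
    - 4 * Im (\<alpha>2 * \<alpha>3) *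
        (((a 2 0 - x $ 2) + a 2 3) * ((a 3 0 - x $ 3) - a 3 3)
          + ((a 2 0 - x $ 2) - a 2 3) * ((a 3 0 - x $ 3) + a 3 3))
    + (cmod (\<alpha>2\<^sup>2 - (cnj \<alpha>3)\<^sup>2))\<^sup>2)"
proof -
  define u v w z :: "complex^3" where
    "u = (\<chi> j. of_real (vector [a 1 0 - x $ 1 + a 1 3, a 2 0 - x $ 2 + a 2 3, a 3 0 - x $ 3 + a 3 3] $ j))"
    and "v = (\<chi> j. of_real (vector [a 1 0 - x $ 1 - a 1 3, a 2 0 - x $ 2 - a 2 3, a 3 0 - x $ 3 - a 3 3] $ j))"
    and "w = vector [0, - \<i> * \<alpha>2, cnj \<alpha>3]"
    and "z = (\<chi> j. cnj (w $ j))"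
  define B where "B j = (vector [vector [u $ j, w $ j], vector [z $ j, v $ j]] :: complex^2^2)" for j
  have "A1 - (x $ 1) *\<^sub>R pauli 0 = B 1"
    using assms(7,8) unfolding assms(4) sum_pauli
    by (simp add: B_def u_def v_def w_def z_def pauli_def vec_eq_iff forall_2 complex_eq_iff)
  moreover have "A2 - (x $ 2) *\<^sub>R pauli 0 = B 2"
    unfolding assms(5) sum_pauli
    by (simp add: B_def u_def v_def w_def z_def pauli_def vec_eq_iff forall_2 complex_eq_iff assms(9))
  moreover have "A3 - (x $ 3) *\<^sub>R pauli 0 = B 3"
    unfolding assms(6) sum_pauli
    by (simp add: B_def u_def v_def w_def z_def pauli_def vec_eq_iff forall_2 complex_eq_iff assms(10))
  ultimately have det: "det (localizer A1 A2 A3 x) =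
      bdot u u * bdot v v + bdot w w * bdot z z
    + 2 * (bdot u v * bdot w z - (bdot u w * bdot v z + bdot u z * bdot v w))"
    unfolding localizer_def B_def by (simp only: det_pauli_blocks diff_diff_eq)

  have uu: "bdot u u = of_real ((a 1 0 - x $ 1 + a 1 3)\<^sup>2 + (a 2 0 - x $ 2 + a 2 3)\<^sup>2 + (a 3 0 - x $ 3 + a 3 3)\<^sup>2)"
    and vv: "bdot v v = of_real ((a 1 0 - x $ 1 - a 1 3)\<^sup>2 + (a 2 0 - x $ 2 - a 2 3)\<^sup>2 + (a 3 0 - x $ 3 - a 3 3)\<^sup>2)"
    by (simp_all add: bdot_def sum_3 u_def v_def power2_eq_square)
  have uv: "bdot u v = of_real (((a 1 0 - x $ 1)\<^sup>2 - (a 1 3)\<^sup>2)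
      + ((a 2 0 - x $ 2)\<^sup>2 - (a 2 3)\<^sup>2) + ((a 3 0 - x $ 3)\<^sup>2 - (a 3 3)\<^sup>2))"
    by (simp add: bdot_def sum_3 u_def v_def power2_eq_square algebra_simps)
  have wz: "bdot w z = of_real ((cmod \<alpha>2)\<^sup>2 + (cmod \<alpha>3)\<^sup>2)"
    by (simp add: bdot_def sum_3 w_def z_def complex_eq_iff cmod_power2)
      (simp add: power2_eq_square)
  have wwzz: "bdot w w * bdot z z = of_real ((cmod (\<alpha>2\<^sup>2 - (cnj \<alpha>3)\<^sup>2))\<^sup>2)"
  proof -
    have "bdot w w = - (\<alpha>2\<^sup>2 - (cnj \<alpha>3)\<^sup>2)" and "bdot z z = cnj (bdot w w)"
      by (simp_all add: bdot_def sum_3 w_def z_def power_mult_distrib flip: power2_eq_square)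
    then show ?thesis
      by (simp only: complex_norm_square complex_cnj_minus minus_mult_minus)
  qed
  (* The two summands are conjugate to each other. *)
  have mixed: "bdot u w * bdot v z + bdot u z * bdot v w =
      of_real (2 * ((a 2 0 - x $ 2 + a 2 3) * (a 2 0 - x $ 2 - a 2 3) * (cmod \<alpha>2)\<^sup>2
        + (a 3 0 - x $ 3 + a 3 3) * (a 3 0 - x $ 3 - a 3 3) * (cmod \<alpha>3)\<^sup>2)
      + 2 * Im (\<alpha>2 * \<alpha>3) * ((a 2 0 - x $ 2 + a 2 3) * (a 3 0 - x $ 3 - a 3 3)
        + (a 2 0 - x $ 2 - a 2 3) * (a 3 0 - x $ 3 + a 3 3)))"
  proof -
    define p q r s where "p = a 2 0 - x $ 2 + a 2 3" and "q = a 3 0 - x $ 3 + a 3 3"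
      and "r = a 2 0 - x $ 2 - a 2 3" and "s = a 3 0 - x $ 3 - a 3 3"
    have "bdot u w * bdot v z + bdot u z * bdot v w =
        (of_real q * cnj \<alpha>3 - of_real p * (\<i> * \<alpha>2)) * (of_real s * \<alpha>3 + of_real r * (\<i> * cnj \<alpha>2))
      + (of_real q * \<alpha>3 + of_real p * (\<i> * cnj \<alpha>2)) * (of_real s * cnj \<alpha>3 - of_real r * (\<i> * \<alpha>2))"
      by (simp add: bdot_def sum_3 u_def v_def w_def z_def p_def q_def r_def s_def add.commute)
    also have "\<dots> = of_real (2 * (p * r * (cmod \<alpha>2)\<^sup>2 + q * s * (cmod \<alpha>3)\<^sup>2)
        + 2 * Im (\<alpha>2 * \<alpha>3) * (p * s + r * q))"
      by (simp add: complex_eq_iff cmod_power2) (simp add: algebra_simps power2_eq_square)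
    finally show ?thesis by (simp only: p_def q_def r_def s_def)
  qed

  have combine: "of_real p * of_real q + of_real m + 2 * (of_real r * of_real n - of_real t)
      = complex_of_real (p * q + m + 2 * (r * n - t))" for p q m r n t
    by simp
  show ?thesis
    unfolding det uu vv uv wz wwzz mixed combine of_real_eq_iff
    by algebra
qed

end
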